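(* Let $X$ be a locally compact Hausdorff space and let $\nu$ be a signed deficient topological measure on $X$. Suppose that at most one of $\nu^{+}(X), \nu^{-}(X)$ is infinite, or that $\nu$ is real-valued. Then $\nu$ is $\tau$-smooth on open sets and $\tau$-smooth on compact sets.
   Context: $\mathcal{O}(X), \mathcal{C}(X), \mathcal{K}(X)$ denote the families of open, closed, compact subsets of $X$. Set functions into the extended reals are assumed not to be identically $\infty$ or identically $-\infty$. A signed deficient topological measure on $X$ is a set function $\nu:\mathcal{C}(X)\cup\mathcal{O}(X)\to[-\infty,\infty]$ that assumes at most one of the values $\infty,-\infty$ and satisfies: (1) $\nu(C\sqcup K)=\nu(C)+\nu(K)$ for disjoint $C,K\in\mathcal{K}(X)$; (2) for $U\in\mathcal{O}(X)$, $\nu(U)=\lim\{\nu(K):K\in\mathcal{K}(X),K\subseteq U\}$ (limit of the net indexed by compact subsets of $U$ ordered by inclusion); (3) for $F\in\mathcal{C}(X)$, $\nu(F)=\lim\{\nu(U):U\in\mathcal{O}(X),F\subseteq U\}$ (limit of the net indexed by open supersets of $F$ ordered by reverse inclusion). It is real-valued if its range is in $\mathbb{R}$. For $U$ open, $\nu^{+}(U)=\sup\{\nu(K):K\subseteq U,K\in\mathcal{K}(X)\}$; for $F$ closed, $\nu^{+}(F)=\inf\{\nu^{+}(U):F\subseteq U,U\in\mathcal{O}(X)\}$; and $\nu^{-}=(-\nu)^{+}$. $\nu$ is $\tau$-smooth on compact sets if $\nu(K_\alpha)\to\nu(K)$ whenever $K_\alpha\searrow K$ with $K_\alpha,K\in\mathcal{K}(X)$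 (a net decreasing under inclusion with intersection $K$). $\nu$ is $\tau$-smooth on open sets if $\nu(U_\alpha)\to\nu(U)$ whenever $U_\alpha\nearrow U$ with $U_\alpha,U\in\mathcal{O}(X)$ (a net increasing under inclusion with union $U$). *)

theory Defs
  imports "HOL-Analysis.Analysis"
begin

section \<open>Nets\<close>

definition directed_index :: "'i set \<Rightarrow> ('i \<Rightarrow> 'i \<Rightarrow> bool) \<Rightarrow> bool" where
  "directed_index I le \<longleftrightarrow>
     I \<noteq> {} \<and>
     (\<forall>i\<in>I. le i i) \<and>
     (\<forall>i\<in>I. \<forall>j\<in>I. \<forall>k\<in>I. le i j \<longrightarrow> le j k \<longrightarrow> le i k) \<and>
     (\<forall>i\<in>I. \<forall>j\<in>I. \<exists>k\<in>I. le i k \<and> le j k)"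

text \<open>
  Convergence of a net \<open>(f i)\<close>, \<open>i \<in> I\<close>, to \<open>l\<close> is \<open>(f \<longlongrightarrow> l) (tail_filter I le)\<close>;
  see \<open>eventually_tail_filter\<close> below.
\<close>

definition tail_filter :: "'i set \<Rightarrow> ('i \<Rightarrow> 'i \<Rightarrow> bool) \<Rightarrow> 'i filter" where
  "tail_filter I le = (INF i\<in>I. principal {j\<in>I. le i j})"

lemma eventually_tail_filter:
  assumes "directed_index I le"
  shows "eventually P (tail_filter I le) \<longleftrightarrow> (\<exists>i\<in>I. \<forall>j\<in>I. le i j \<longrightarrow> P j)"
proof -
  have "\<exists>k\<in>I. principal {l\<in>I. le k l} \<le> inf (principal {l\<in>I. le i l}) (principal {l\<in>I. le j l})"
    if ij: "i \<in> I" "j \<in> I" for i j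
  proof -
    obtain k where k: "k \<in> I" "le i k" "le j k"
      using assms ij unfolding directed_index_def by meson
    have "{l\<in>I. le k l} \<subseteq> {l\<in>I. le i l} \<inter> {l\<in>I. le j l}"
      using assms ij k unfolding directed_index_def by blast
    then show ?thesis
      using k(1) by auto
  qed
  moreover have "I \<noteq> {}"
    using assms by (simp add: directed_index_def)
  ultimately have "eventually P (tail_filter I le) \<longleftrightarrow>
      (\<exists>i\<in>I. eventually P (principal {j\<in>I. le i j}))"
    unfolding tail_filter_def by (intro eventually_INF_base) auto
  then show ?thesis
    by (auto simp: eventually_principal)
qed


section \<open>Signed deficient topological measures\<close>

text \<open>
  A set function on the open and closed subsets of \<open>X\<close> is a total function on \<open>'a set\<close>
  whose values are only ever used on \<open>open_or_closed X\<close>; in a Hausdorff space this family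
  contains the compact sets.
\<close>

definition open_or_closed :: "'a topology \<Rightarrow> 'a set set" where
  "open_or_closed X = {A. closedin X A \<or> openin X A}"

text \<open>
  The two conditions that \<open>\<nu>\<close> is not identically \<open>\<infinity>\<close> and not identically \<open>-\<infinity>\<close> are the
  standing convention for extended-real-valued set functions.
\<close>

definition signed_deficient_topological_measure :: "'a topology \<Rightarrow> ('a set \<Rightarrow> ereal) \<Rightarrow> bool" where
  "signed_deficient_topological_measure X \<nu> \<longleftrightarrow>
     (\<exists>A\<in>open_or_closed X. \<nu> A \<noteq> \<infinity>) \<and>
     (\<exists>A\<in>open_or_closed X. \<nu> A \<noteq> -\<infinity>) \<and>
     \<not> ((\<exists>A\<in>open_or_closed X. \<nu> A = \<infinity>) \<and> (\<exists>A\<in>open_or_closed X. \<nu> A = -\<infinity>)) \<and>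
     (\<forall>C K. compactin X C \<and> compactin X K \<and> C \<inter> K = {} \<longrightarrow> \<nu> (C \<union> K) = \<nu> C + \<nu> K) \<and>
     (\<forall>U. openin X U \<longrightarrow> (\<nu> \<longlongrightarrow> \<nu> U) (tail_filter {K. compactin X K \<and> K \<subseteq> U} (\<lambda>K L. K \<subseteq> L))) \<and>
     (\<forall>F. closedin X F \<longrightarrow> (\<nu> \<longlongrightarrow> \<nu> F) (tail_filter {U. openin X U \<and> F \<subseteq> U} (\<lambda>U V. V \<subseteq> U)))"

definition real_valued_on :: "'a topology \<Rightarrow> ('a set \<Rightarrow> ereal) \<Rightarrow> bool" where
  "real_valued_on X \<nu> \<longleftrightarrow> \<nu> ` open_or_closed X \<subseteq> range ereal"

text \<open>
  On a set that is both open and closed the two defining formulas agree, since the supremum is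
  monotone in the open set.
\<close>

definition pos_variation :: "'a topology \<Rightarrow> ('a set \<Rightarrow> ereal) \<Rightarrow> 'a set \<Rightarrow> ereal" where
  "pos_variation X \<nu> A =
     (if openin X A then (SUP K\<in>{K. compactin X K \<and> K \<subseteq> A}. \<nu> K)
      else (INF U\<in>{U. openin X U \<and> A \<subseteq> U}. (SUP K\<in>{K. compactin X K \<and> K \<subseteq> U}. \<nu> K)))"

definition neg_variation :: "'a topology \<Rightarrow> ('a set \<Rightarrow> ereal) \<Rightarrow> 'a set \<Rightarrow> ereal" where
  "neg_variation X \<nu> = pos_variation X (\<lambda>A. - \<nu> A)"


section \<open>Smoothness along nets\<close>

text \<open>
  A definition cannot quantify over the type of the index set, so that type is a parameter; a
  theorem about a free type variable \<open>'i\<close> covers nets over every directed set.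
\<close>

definition tau_smooth_on_compact_sets ::
    "'i itself \<Rightarrow> 'a topology \<Rightarrow> ('a set \<Rightarrow> ereal) \<Rightarrow> bool" where
  "tau_smooth_on_compact_sets _ X \<nu> \<longleftrightarrow>
     (\<forall>(I :: 'i set) le (K :: 'i \<Rightarrow> 'a set) K0.
        directed_index I le \<and>
        (\<forall>i\<in>I. compactin X (K i)) \<and> compactin X K0 \<and>
        (\<forall>i\<in>I. \<forall>j\<in>I. le i j \<longrightarrow> K j \<subseteq> K i) \<and>
        (\<Inter>i\<in>I. K i) = K0
        \<longrightarrow> ((\<lambda>i. \<nu> (K i)) \<longlongrightarrow> \<nu> K0) (tail_filter I le))"

definition tau_smooth_on_open_sets ::
    "'i itself \<Rightarrow> 'a topology \<Rightarrow> ('a set \<Rightarrow> ereal) \<Rightarrow> bool" where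
  "tau_smooth_on_open_sets _ X \<nu> \<longleftrightarrow>
     (\<forall>(I :: 'i set) le (U :: 'i \<Rightarrow> 'a set) U0.
        directed_index I le \<and>
        (\<forall>i\<in>I. openin X (U i)) \<and> openin X U0 \<and>
        (\<forall>i\<in>I. \<forall>j\<in>I. le i j \<longrightarrow> U i \<subseteq> U j) \<and>
        (\<Union>i\<in>I. U i) = U0
        \<longrightarrow> ((\<lambda>i. \<nu> (U i)) \<longlongrightarrow> \<nu> U0) (tail_filter I le))"

end

theory Submission
  imports Defs
begin

text \<open>
  Both smoothness claims rest on one principle about iterated limits. The regularity conditions
  say that \<open>\<nu>\<close> on an open set is its limit along compact subsets, and on a closed set its
  limit along open supersets. Let \<open>U\<^sub>i\<close> increase to \<open>U\<close>, and suppose \<open>\<nu>\<close> is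
  within a prescribed neighbourhood of \<open>\<nu> U\<close> on all compact sets between some compact \<open>K\<close>
  and \<open>U\<close>. By compactness, \<open>U\<^sub>i\<close> eventually contains \<open>K\<close>, and from then on \<open>\<nu> (U\<^sub>i)\<close>
  is itself a limit of values of \<open>\<nu>\<close> on such intermediate compact sets, so it lies in the closure
  of the prescribed neighbourhood. As closed neighbourhoods form a base at each point of the extended
  reals, this gives convergence. The argument for compact sets decreasing to \<open>K\<close> is dual: an open
  superset of \<open>K\<close> eventually contains \<open>K\<^sub>i\<close>, and \<open>\<nu> (K\<^sub>i)\<close> is a limit of values on
  intermediate open sets. The lemma \<open>tendsto_iterated_limit\<close> isolates the limit argument, and
  \<open>compactin_directed_Union\<close> and \<open>openin_directed_Inter_compactin\<close> supply the two compactness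
  arguments.
\<close>

section \<open>Tail filters and iterated limits\<close>

lemma tail_filter_neq_bot:
  assumes "directed_index I le"
  shows "tail_filter I le \<noteq> bot"
proof
  assume "tail_filter I le = bot"
  then have "eventually (\<lambda>_. False) (tail_filter I le)"
    by simp
  then obtain i where "i \<in> I" "\<forall>j\<in>I. \<not> le i j"
    unfolding eventually_tail_filter[OF assms] by auto
  moreover have "\<forall>i\<in>I. le i i"
    using assms by (simp add: directed_index_def)
  ultimately show False
    by blast
qed

lemma eventually_tail_filterI:
  assumes "directed_index I le" and "i \<in> I" and "\<And>j. \<lbrakk>j \<in> I; le i j\<rbrakk> \<Longrightarrow> P j"
  shows "eventually P (tail_filter I le)"
  using assms(2,3) unfolding eventually_tail_filter[OF assms(1)] by blast

lemma eventually_tail_filter_index: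
  assumes "directed_index I le" and "\<And>i. i \<in> I \<Longrightarrow> P i"
  shows "eventually P (tail_filter I le)"
proof -
  obtain i where "i \<in> I"
    using assms(1) by (auto simp: directed_index_def)
  then show ?thesis
    using assms(2) by (rule eventually_tail_filterI[OF assms(1)])
qed

text \<open>
  A strict bound \<open>b < f\<close> holding in \<open>F\<close> holds in \<open>G j\<close> for late \<open>j\<close>, and passes to the
  limit as the weak bound \<open>b \<le> g j\<close>; density of the order leaves room to choose \<open>b\<close>
  strictly between \<open>l\<close> and the bound to be proved.
\<close>

lemma tendsto_iterated_limit:
  fixes f :: "'b \<Rightarrow> 'c::{dense_linorder,linorder_topology}"
  assumes lim: "(f \<longlongrightarrow> l) F"
    and inner: "eventually (\<lambda>j. G j \<noteq> bot \<and> (f \<longlongrightarrow> g j) (G j)) H"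
    and finer: "\<And>P. eventually P F \<Longrightarrow> eventually (\<lambda>j. eventually P (G j)) H"
  shows "(g \<longlongrightarrow> l) H"
proof (rule order_tendstoI)
  fix a assume "a < l"
  then obtain b where b: "a < b" "b < l"
    using dense by blast
  have "eventually (\<lambda>x. b < f x) F"
    using lim b(2) by (rule order_tendstoD)
  from finer[OF this] inner show "eventually (\<lambda>j. a < g j) H"
  proof eventually_elim
    case (elim j)
    then have "b \<le> g j"
      by (intro tendsto_lowerbound[of f "g j" "G j" b]) (auto elim: eventually_mono)
    with b(1) show ?case by simp
  qed
next
  fix a assume "l < a"
  then obtain b where b: "l < b" "b < a"
    using dense by blast
  have "eventually (\<lambda>x. f x < b) F"
    using lim b(1) by (rule order_tendstoD)
  from finer[OF this] inner show "eventually (\<lambda>j. g j < a) H"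
  proof eventually_elim
    case (elim j)
    then have "g j \<le> b"
      by (intro tendsto_upperbound[of f "g j" "G j" b]) (auto elim: eventually_mono)
    with b(2) show ?case by simp
  qed
qed

section \<open>Compactness along directed families\<close>

lemma directed_index_finite_upper_bound:
  assumes "directed_index I le" and "finite J" and "J \<subseteq> I"
  shows "\<exists>k\<in>I. \<forall>j\<in>J. le j k"
  using assms(2,3)
proof (induction J rule: finite_induct)
  case empty
  then show ?case
    using assms(1) unfolding directed_index_def by blast
next
  case (insert i J)
  then obtain k where k: "k \<in> I" "\<forall>j\<in>J. le j k"
    by blast
  obtain m where "m \<in> I" "le i m" "le k m"
    using assms(1) insert.prems k(1) unfolding directed_index_def by blast
  with k insert.prems show ?case
    using assms(1) unfolding directed_index_def by blast
qed

lemma compactin_directed_Union: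
  assumes dir: "directed_index I le"
    and op: "\<And>i. i \<in> I \<Longrightarrow> openin X (U i)"
    and mono: "\<And>i j. \<lbrakk>i \<in> I; j \<in> I; le i j\<rbrakk> \<Longrightarrow> U i \<subseteq> U j"
    and K: "compactin X K" "K \<subseteq> (\<Union>i\<in>I. U i)"
  shows "\<exists>i\<in>I. K \<subseteq> U i"
proof -
  have "\<And>V. V \<in> U ` I \<Longrightarrow> openin X V"
    using op by auto
  from compactinD[OF K(1) this K(2)]
  obtain \<F> where \<F>: "finite \<F>" "\<F> \<subseteq> U ` I" "K \<subseteq> \<Union>\<F>"
    by auto
  obtain J where J: "finite J" "J \<subseteq> I" "\<F> = U ` J"
    using finite_subset_image[OF \<F>(1,2)] by blast
  obtain k where k: "k \<in> I" "\<forall>j\<in>J. le j k"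
    using directed_index_finite_upper_bound[OF dir J(1,2)] by blast
  have "U j \<subseteq> U k" if "j \<in> J" for j
    using that J(2) k by (intro mono) auto
  then have "\<Union>\<F> \<subseteq> U k"
    unfolding J(3) by (rule UN_least)
  with \<F>(3) k(1) show ?thesis
    by blast
qed

text \<open>
  One member \<open>K\<^sub>i\<^sub>0\<close> of the family is covered by \<open>V\<close> together with the increasing open sets
  complementary to the \<open>K\<^sub>i\<close>, so a single one of these complements already covers the
  compact set \<open>K\<^sub>i\<^sub>0 - V\<close>.
\<close>

lemma openin_directed_Inter_compactin:
  assumes haus: "Hausdorff_space X"
    and dir: "directed_index I le"
    and comp: "\<And>i. i \<in> I \<Longrightarrow> compactin X (K i)"
    and mono: "\<And>i j. \<lbrakk>i \<in> I; j \<in> I; le i j\<rbrakk> \<Longrightarrow> K j \<subseteq> K i"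
    and V: "openin X V" "(\<Inter>i\<in>I. K i) \<subseteq> V"
  shows "\<exists>i\<in>I. K i \<subseteq> V"
proof -
  obtain i0 where i0: "i0 \<in> I"
    using dir unfolding directed_index_def by blast
  have sub: "K i \<subseteq> topspace X" if "i \<in> I" for i
    using comp[OF that] by (rule compactin_subset_topspace)
  have "K i0 - V = K i0 \<inter> (topspace X - V)"
    using sub[OF i0] by blast
  then have "compactin X (K i0 - V)"
    using comp[OF i0] V(1) by (metis closed_Int_compactin Int_commute closedin_diff closedin_topspace)
  moreover have "K i0 - V \<subseteq> (\<Union>i\<in>I. topspace X - K i)"
    using V(2) sub[OF i0] by blast
  moreover have "openin X (topspace X - K i)" if "i \<in> I" for i
    using compactin_imp_closedin[OF haus comp[OF that]] by (rule openin_diff[OF openin_topspace])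
  moreover have "topspace X - K i \<subseteq> topspace X - K j" if "i \<in> I" "j \<in> I" "le i j" for i j
    using mono[OF that] by blast
  ultimately have "\<exists>j\<in>I. K i0 - V \<subseteq> topspace X - K j"
    by (intro compactin_directed_Union[OF dir, where X = X])
  then obtain j where j: "j \<in> I" "K i0 - V \<subseteq> topspace X - K j"
    by blast
  obtain k where k: "k \<in> I" "le i0 k" "le j k"
    using dir i0 j(1) unfolding directed_index_def by blast
  have "K k \<subseteq> K i0" "K k \<subseteq> K j"
    using mono[OF i0 k(1,2)] mono[OF j(1) k(1,3)] .
  with j(2) sub[OF k(1)] have "K k \<subseteq> V"
    by blast
  with k(1) show ?thesis
    by blast
qed

section \<open>Smoothness from regularity\<close>

lemma directed_index_compact_subsets:
  "directed_index {K. compactin X K \<and> K \<subseteq> U} (\<lambda>K L. K \<subseteq> L)"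
  unfolding directed_index_def
proof (intro conjI ballI impI)
  show "{K. compactin X K \<and> K \<subseteq> U} \<noteq> {}"
    using compactin_empty by blast
next
  fix K L
  assume "K \<in> {K. compactin X K \<and> K \<subseteq> U}" "L \<in> {K. compactin X K \<and> K \<subseteq> U}"
  then have "K \<union> L \<in> {K. compactin X K \<and> K \<subseteq> U}"
    by (auto intro: compactin_Un)
  then show "\<exists>M\<in>{K. compactin X K \<and> K \<subseteq> U}. K \<subseteq> M \<and> L \<subseteq> M"
    by blast
qed auto

lemma directed_index_open_supersets:
  assumes "F \<subseteq> topspace X"
  shows "directed_index {U. openin X U \<and> F \<subseteq> U} (\<lambda>U V. V \<subseteq> U)"
  unfolding directed_index_def
proof (intro conjI ballI impI)
  show "{U. openin X U \<and> F \<subseteq> U} \<noteq> {}"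
    using assms openin_topspace by blast
next
  fix U V
  assume "U \<in> {U. openin X U \<and> F \<subseteq> U}" "V \<in> {U. openin X U \<and> F \<subseteq> U}"
  then have "U \<inter> V \<in> {U. openin X U \<and> F \<subseteq> U}"
    by auto
  then show "\<exists>W\<in>{U. openin X U \<and> F \<subseteq> U}. W \<subseteq> U \<and> W \<subseteq> V"
    by blast
qed auto

lemma tau_smooth_on_open_sets_if_inner_limit:
  fixes \<nu> :: "'a set \<Rightarrow> ereal"
  assumes inner: "\<And>U. openin X U \<Longrightarrow>
      (\<nu> \<longlongrightarrow> \<nu> U) (tail_filter {K. compactin X K \<and> K \<subseteq> U} (\<lambda>K L. K \<subseteq> L))"
  shows "tau_smooth_on_open_sets TYPE('i) X \<nu>"
  unfolding tau_smooth_on_open_sets_def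
proof (intro allI impI, elim conjE)
  fix I :: "'i set" and le U U0
  assume dir: "directed_index I le"
    and op: "\<forall>i\<in>I. openin X (U i)" "openin X U0"
    and mono: "\<forall>i\<in>I. \<forall>j\<in>I. le i j \<longrightarrow> U i \<subseteq> U j"
    and U0: "(\<Union>i\<in>I. U i) = U0"
  let ?G = "\<lambda>V. tail_filter {K. compactin X K \<and> K \<subseteq> V} (\<lambda>K L. K \<subseteq> L)"
  show "((\<lambda>i. \<nu> (U i)) \<longlongrightarrow> \<nu> U0) (tail_filter I le)"
  proof (rule tendsto_iterated_limit[OF inner[OF op(2)]])
    show "\<forall>\<^sub>F i in tail_filter I le. ?G (U i) \<noteq> bot \<and> (\<nu> \<longlongrightarrow> \<nu> (U i)) (?G (U i))"
      by (rule eventually_tail_filter_index[OF dir], intro conjI inner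
          tail_filter_neq_bot directed_index_compact_subsets) (use op(1) in blast)
  next
    fix P assume "eventually P (?G U0)"
    then obtain K where "K \<in> {K. compactin X K \<and> K \<subseteq> U0}"
      and PK: "\<forall>L\<in>{K. compactin X K \<and> K \<subseteq> U0}. K \<subseteq> L \<longrightarrow> P L"
      unfolding eventually_tail_filter[OF directed_index_compact_subsets] by (rule bexE)
    then have K: "compactin X K" "K \<subseteq> U0"
      by simp_all
    have P: "P L" if "compactin X L" "L \<subseteq> U0" "K \<subseteq> L" for L
      using PK that by simp
    have "\<exists>i\<in>I. K \<subseteq> U i"
      by (rule compactin_directed_Union[OF dir]) (use op(1) mono K U0 in simp_all)
    then obtain i where i: "i \<in> I" "K \<subseteq> U i"
      by blast
    have "eventually P (?G (U j))" if "j \<in> I" "le i j" for j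
    proof -
      have "U i \<subseteq> U j"
        using mono i(1) that by simp
      with i(2) have "K \<subseteq> U j"
        by (rule subset_trans)
      moreover have "U j \<subseteq> U0"
        using that(1) U0 by blast
      ultimately show ?thesis
        using K(1)
        by (intro eventually_tail_filterI[OF directed_index_compact_subsets, of K] P) auto
    qed
    with i(1) show "\<forall>\<^sub>F i in tail_filter I le. eventually P (?G (U i))"
      by (rule eventually_tail_filterI[OF dir])
  qed
qed

lemma tau_smooth_on_compact_sets_if_outer_limit:
  fixes \<nu> :: "'a set \<Rightarrow> ereal"
  assumes haus: "Hausdorff_space X"
    and outer: "\<And>F. closedin X F \<Longrightarrow>
      (\<nu> \<longlongrightarrow> \<nu> F) (tail_filter {U. openin X U \<and> F \<subseteq> U} (\<lambda>U V. V \<subseteq> U))"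
  shows "tau_smooth_on_compact_sets TYPE('i) X \<nu>"
  unfolding tau_smooth_on_compact_sets_def
proof (intro allI impI, elim conjE)
  fix I :: "'i set" and le K K0
  assume dir: "directed_index I le"
    and comp: "\<forall>i\<in>I. compactin X (K i)" "compactin X K0"
    and mono: "\<forall>i\<in>I. \<forall>j\<in>I. le i j \<longrightarrow> K j \<subseteq> K i"
    and K0: "(\<Inter>i\<in>I. K i) = K0"
  let ?G = "\<lambda>F. tail_filter {U. openin X U \<and> F \<subseteq> U} (\<lambda>U V. V \<subseteq> U)"
  have outer': "(\<nu> \<longlongrightarrow> \<nu> C) (?G C)" if "compactin X C" for C
    using outer compactin_imp_closedin[OF haus that] by blast
  have dir': "directed_index {U. openin X U \<and> C \<subseteq> U} (\<lambda>U V. V \<subseteq> U)" if "compactin X C" for C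
    using that by (intro directed_index_open_supersets compactin_subset_topspace)
  show "((\<lambda>i. \<nu> (K i)) \<longlongrightarrow> \<nu> K0) (tail_filter I le)"
  proof (rule tendsto_iterated_limit[OF outer'[OF comp(2)]])
    show "\<forall>\<^sub>F i in tail_filter I le. ?G (K i) \<noteq> bot \<and> (\<nu> \<longlongrightarrow> \<nu> (K i)) (?G (K i))"
      by (rule eventually_tail_filter_index[OF dir], intro conjI outer'
          tail_filter_neq_bot dir') (use comp(1) in blast)+
  next
    fix P assume "eventually P (?G K0)"
    then obtain V where "V \<in> {U. openin X U \<and> K0 \<subseteq> U}"
      and PV: "\<forall>W\<in>{U. openin X U \<and> K0 \<subseteq> U}. W \<subseteq> V \<longrightarrow> P W"
      unfolding eventually_tail_filter[OF dir'[OF comp(2)]] by (rule bexE)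
    then have V: "openin X V" "K0 \<subseteq> V"
      by simp_all
    have P: "P W" if "openin X W" "K0 \<subseteq> W" "W \<subseteq> V" for W
      using PV that by simp
    have "\<exists>i\<in>I. K i \<subseteq> V"
      by (rule openin_directed_Inter_compactin[OF haus dir]) (use comp(1) mono V K0 in simp_all)
    then obtain i where i: "i \<in> I" "K i \<subseteq> V"
      by blast
    have "eventually P (?G (K j))" if j: "j \<in> I" "le i j" for j
    proof -
      have "K j \<subseteq> K i"
        using mono i(1) j by simp
      then have "K j \<subseteq> V"
        using i(2) by (rule subset_trans)
      moreover have "compactin X (K j)"
        using comp(1) j(1) by simp
      moreover have "K0 \<subseteq> K j"
        using j(1) K0 by blast
      ultimately show ?thesis
        using V(1)
        by (intro eventually_tail_filterI[OF dir', of "K j" V] P) auto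
    qed
    with i(1) show "\<forall>\<^sub>F i in tail_filter I le. eventually P (?G (K i))"
      by (rule eventually_tail_filterI[OF dir])
  qed
qed

theorem theorem20:
  fixes X :: "'a topology" and \<nu> :: "'a set \<Rightarrow> ereal"
  assumes "locally_compact_space X" and "Hausdorff_space X"
    and "signed_deficient_topological_measure X \<nu>"
    and "\<not> (\<bar>pos_variation X \<nu> (topspace X)\<bar> = \<infinity> \<and> \<bar>neg_variation X \<nu> (topspace X)\<bar> = \<infinity>)
         \<or> real_valued_on X \<nu>"
  shows "tau_smooth_on_open_sets TYPE('i) X \<nu> \<and> tau_smooth_on_compact_sets TYPE('i) X \<nu>"
proof
  show "tau_smooth_on_open_sets TYPE('i) X \<nu>"
    using assms(3) unfolding signed_deficient_topological_measure_def
    by (intro tau_smooth_on_open_sets_if_inner_limit) simp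
  show "tau_smooth_on_compact_sets TYPE('i) X \<nu>"
    using assms(3) unfolding signed_deficient_topological_measure_def
    by (intro tau_smooth_on_compact_sets_if_outer_limit[OF assms(2)]) simp
qed

end
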